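(* Let $T>0$, $A\ge 0$, and let $b:\mathbb{R}\times(-\infty,T]\to\mathbb{R}$ be a continuous function $b(y,t)$, differentiable in $y$ with $\partial b/\partial y$ continuous in $(y,t)$, satisfying $\sup\{|\partial b(y,t)/\partial y| : y\in\mathbb{R},\ t\le T\}\le A$, and suppose $b(y,t)$ is concave in $y\in\mathbb{R}$ for every $t\le T$. Let $\varepsilon>0$ and let $q_\varepsilon$ be the function defined in the context. Then for any fixed $x\in\mathbb{R}$ and $0\le t<T$, the function $y\mapsto q_\varepsilon(x,y,t)$ is a convex function of $y\in\mathbb{R}$.
   Context: Let $Y_\varepsilon$ be the solution of $dY_\varepsilon(s)=b(Y_\varepsilon(s),s)\,ds+\sqrt{\varepsilon}\,dW(s)$, $t\le s\le T$, with $W$ Brownian motion. For $x,y\in\mathbb{R}$, $t<T$ put $u_\varepsilon(x,y,t)=P(Y_\varepsilon(T)>x \mid Y_\varepsilon(t)=y)$ (equivalently, $u_\varepsilon$ is the bounded solution of $\partial_t u_\varepsilon+b(y,t)\partial_y u_\varepsilon+\frac{\varepsilon}{2}\partial_y^2u_\varepsilon=0$, $t<T$, with terminal limit $0$ for $y<x$ and $1$ for $y>x$), and define $q_\varepsilon$ by $u_\varepsilon(x,y,t)=\exp[-q_\varepsilon(x,y,t)/\varepsilon]$. *)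

theory Defs
  imports "HOL-Probability.Probability"
begin

text \<open>Standard one-dimensional Brownian motion on the time set $[0,\infty)$. The values \<open>W s\<close> at
  negative times \<open>s\<close> are unconstrained and never used.\<close>

locale brownian_motion = prob_space M for M :: "'a measure" and W :: "real \<Rightarrow> 'a \<Rightarrow> real" +
  assumes random_variable_W: "\<And>s. 0 \<le> s \<Longrightarrow> W s \<in> borel_measurable M"
    and start_zero: "AE \<omega> in M. W 0 \<omega> = 0"
    and indep_increments:
      "\<And>(\<tau> :: nat \<Rightarrow> real) n. 0 \<le> \<tau> 0 \<Longrightarrow> (\<forall>i<n. \<tau> i < \<tau> (Suc i)) \<Longrightarrow>
         indep_vars (\<lambda>_. borel) (\<lambda>i \<omega>. W (\<tau> (Suc i)) \<omega> - W (\<tau> i) \<omega>) {..<n}"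
    and normal_increments:
      "\<And>r s. 0 \<le> r \<Longrightarrow> r < s \<Longrightarrow>
         distributed M lborel (\<lambda>\<omega>. W s \<omega> - W r \<omega>) (normal_density 0 (sqrt (s - r)))"
    and continuous_paths: "AE \<omega> in M. continuous_on {0..} (\<lambda>s. W s \<omega>)"

text \<open>\<open>X\<close> solves $dX(s) = b(X(s),s)\,ds + \sqrt{\varepsilon}\,dW(s)$ on $[t,T]$ with $X(t) = y$.
  The noise is additive, so the integral form of the equation involves no stochastic integral and
  is read path by path. Adaptedness of \<open>X\<close> need not be required: for drifts that are Lipschitz in
  the space variable the path of \<open>X\<close> is determined by \<open>y\<close> and the path of \<open>W\<close> on $[t,T]$.\<close>

definition sde_solution ::
  "'a measure \<Rightarrow> (real \<Rightarrow> 'a \<Rightarrow> real) \<Rightarrow> (real \<Rightarrow> real \<Rightarrow> real) \<Rightarrow> real \<Rightarrow> real \<Rightarrow> real \<Rightarrow> real \<Rightarrow>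
     (real \<Rightarrow> 'a \<Rightarrow> real) \<Rightarrow> bool" where
  "sde_solution M W b \<epsilon> t T y X \<longleftrightarrow>
     (\<forall>s\<in>{t..T}. X s \<in> borel_measurable M) \<and>
     (AE \<omega> in M. continuous_on {t..T} (\<lambda>s. X s \<omega>) \<and>
        (\<forall>s\<in>{t..T}. X s \<omega> = y + integral {t..s} (\<lambda>r. b (X r \<omega>) r)
                              + sqrt \<epsilon> * (W s \<omega> - W t \<omega>)))"

text \<open>Here \<open>Y y\<close> stands for the solution that starts from \<open>y\<close> at the initial time; conditioning on
  the initial value \<open>y\<close> means evaluating the law of that solution.\<close>

definition u_eps ::
  "'a measure \<Rightarrow> (real \<Rightarrow> real \<Rightarrow> 'a \<Rightarrow> real) \<Rightarrow> real \<Rightarrow> real \<Rightarrow> real \<Rightarrow> real" where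
  "u_eps M Y T x y = measure M {\<omega> \<in> space M. Y y T \<omega> > x}"

definition q_eps ::
  "real \<Rightarrow> 'a measure \<Rightarrow> (real \<Rightarrow> real \<Rightarrow> 'a \<Rightarrow> real) \<Rightarrow> real \<Rightarrow> real \<Rightarrow> real \<Rightarrow> real" where
  "q_eps \<epsilon> M Y T x y = - \<epsilon> * ln (u_eps M Y T x y)"

text \<open>For a solution of the equation the probability is positive, as the noise is nondegenerate;
  then \<open>q_eps\<close> is the unique solution of $u = \exp(-q/\varepsilon)$.\<close>

lemma q_eps_unique:
  assumes "\<epsilon> > 0" "u_eps M Y T x y > 0"
  shows "u_eps M Y T x y = exp (- q / \<epsilon>) \<longleftrightarrow> q = q_eps \<epsilon> M Y T x y"
proof
  assume "u_eps M Y T x y = exp (- q / \<epsilon>)"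
  then show "q = q_eps \<epsilon> M Y T x y"
    using assms by (simp add: q_eps_def)
next
  assume "q = q_eps \<epsilon> M Y T x y"
  then show "u_eps M Y T x y = exp (- q / \<epsilon>)"
    using assms by (simp add: q_eps_def)
qed

end

theory Submission
  imports Defs
begin

text \<open>
  Concavity of the drift is inherited, in the form of log-concavity, by the tail probabilities
  $u(y) = P(Y^y(T) > x)$, and $q = -\varepsilon \ln u$. The inheritance is visible on the Euler
  scheme with $n$ steps of length $h$. Its tail probabilities are computed backwards in time,
  starting from the indicator of $(x, \infty)$, by two alternating operations: a Gaussian average,
  and composition with a map $y \mapsto y + h\, b(y, s)$. The Gaussian average preserves
  log-concavity (\<open>log_concave_gauss_mean\<close>). The map is concave, and increasing once $h A \le 1$;
  since all the functions involved are increasing, the composition preserves log-concavity too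
  (\<open>log_concave_comp_concave\<close>).

  The noise being additive, the Euler scheme converges path by path (\<open>euler_tendsto\<close>), and the
  inequalities pass to the limit. As the law of the solution might have atoms a priori, levels are
  moved a little in the limit and moved back by continuity from the right. It follows that $u$ is
  increasing with $u(y_1)\, u(y_2) \le u((y_1 + y_2)/2)^2$; for a monotone function, midpoint
  convexity is convexity (\<open>convex_on_midpoint_antimono\<close>).

  For $\ln u$ to be the true logarithm, $u$ must be positive. This is obtained from a Harnack
  inequality $u(y + D)^2 \le C_D\, u(y)$, up to a shift of the level. It holds for the Euler scheme
  with a constant independent of $n$: the distance $D$ is absorbed by a small shift of each noise
  variable, at a cost given by the Cauchy--Schwarz inequality (\<open>tail_prob_harnack\<close>). Since
  $Y^{y + D}(T) \ge Y^y(T) + e^{-A(T - t)} D$, the left-hand side is positive for large $D$.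
\<close>

section \<open>Log-concavity and Gaussian averages\<close>

text \<open>The four-point form of log-concavity: it makes sense where \<open>f\<close> vanishes, it passes to pointwise
  limits, and it says that the kernel $(p, q) \mapsto f(p + q)$ is of one sign in the sense of
  $2 \times 2$ determinants, which is what survives an integration.\<close>

definition log_concave :: "(real \<Rightarrow> real) \<Rightarrow> bool" where
  "log_concave f \<longleftrightarrow> (\<forall>x d e. 0 \<le> d \<longrightarrow> 0 \<le> e \<longrightarrow> f x * f (x + d + e) \<le> f (x + d) * f (x + e))"

definition mono_unit :: "(real \<Rightarrow> real) \<Rightarrow> bool" where
  "mono_unit f \<longleftrightarrow> mono f \<and> (\<forall>y. 0 \<le> f y \<and> f y \<le> 1)"

definition gauss_mean :: "real \<Rightarrow> (real \<Rightarrow> real) \<Rightarrow> real \<Rightarrow> real" where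
  "gauss_mean s f y = (\<integral>z. f (y + z) * normal_density 0 s z \<partial>lborel)"

lemma measurable_mono_unit: "mono_unit f \<Longrightarrow> f \<in> borel_measurable borel"
  by (simp add: mono_unit_def borel_measurable_mono)

lemma integrable_mono_unit_times_normal:
  assumes f: "mono_unit f" and s: "0 < s"
  shows "integrable lborel (\<lambda>z. f (y + z) * normal_density m s z)"
proof (rule Bochner_Integration.integrable_bound)
  show "integrable lborel (normal_density m s)" using s by simp
  show "(\<lambda>z. f (y + z) * normal_density m s z) \<in> borel_measurable lborel"
    using measurable_mono_unit[OF f] by measurable
  show "AE z in lborel. norm (f (y + z) * normal_density m s z) \<le> norm (normal_density m s z)"
    using f by (auto simp: mono_unit_def abs_mult intro!: mult_left_le_one_le)
qed

lemma mono_unit_gauss_mean: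
  assumes f: "mono_unit f" and s: "0 < s"
  shows "mono_unit (gauss_mean s f)"
  unfolding mono_unit_def
proof (intro conjI allI monoI)
  note int = integrable_mono_unit_times_normal[OF f s]
  show "gauss_mean s f x \<le> gauss_mean s f y" if "x \<le> y" for x y
    unfolding gauss_mean_def using f that
    by (intro integral_mono int mult_right_mono) (auto simp: mono_unit_def mono_def)
  show "0 \<le> gauss_mean s f y" for y
    unfolding gauss_mean_def using f by (intro integral_nonneg_AE) (auto simp: mono_unit_def)
  have "gauss_mean s f y \<le> (\<integral>z. normal_density 0 s z \<partial>lborel)" for y
    unfolding gauss_mean_def using f s
    by (intro integral_mono int) (auto simp: mono_unit_def intro!: mult_left_le_one_le)
  then show "gauss_mean s f y \<le> 1" for y using s by simp
qed

lemma gauss_mean_shift: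
  assumes "0 < s"
  shows "gauss_mean s f (y + e) = (\<integral>z. f (y + z) * normal_density e s z \<partial>lborel)"
proof -
  have "(\<integral>z. f (y + z) * normal_density e s z \<partial>lborel)
      = (\<integral>z. f (y + (e + 1 * z)) * normal_density e s (e + 1 * z) \<partial>lborel)"
    by (subst lborel_integral_real_affine[where c = 1 and t = e]) auto
  also have "\<dots> = gauss_mean s f (y + e)"
    by (simp add: gauss_mean_def normal_density_def add.assoc)
  finally show ?thesis by simp
qed

text \<open>Two determinants of opposite sign integrate to a determinant of nonpositive sign (the $2 \times 2$
  case of the formula of Cauchy--Binet and Andreief). Expanding the product in \<open>sign\<close> and integrating
  over \<open>t\<close> and then over \<open>s\<close> gives twice the difference of the two sides, so that the product
  measure is avoided.\<close>

lemma integral_product_exchange: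
  fixes F1 F2 G1 G2 :: "'a \<Rightarrow> real"
  assumes int [simp]: "integrable N (\<lambda>s. F1 s * G1 s)" "integrable N (\<lambda>s. F1 s * G2 s)"
      "integrable N (\<lambda>s. F2 s * G1 s)" "integrable N (\<lambda>s. F2 s * G2 s)"
    and sign: "\<And>s t. (F1 s * F2 t - F1 t * F2 s) * (G1 s * G2 t - G1 t * G2 s) \<le> 0"
  shows "(\<integral>s. F1 s * G1 s \<partial>N) * (\<integral>s. F2 s * G2 s \<partial>N)
       \<le> (\<integral>s. F1 s * G2 s \<partial>N) * (\<integral>s. F2 s * G1 s \<partial>N)"
proof -
  let ?I11 = "\<integral>s. F1 s * G1 s \<partial>N" and ?I12 = "\<integral>s. F1 s * G2 s \<partial>N"
  let ?I21 = "\<integral>s. F2 s * G1 s \<partial>N" and ?I22 = "\<integral>s. F2 s * G2 s \<partial>N"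
  have inner: "(F1 s * G1 s) * ?I22 - (F1 s * G2 s) * ?I21
             - (F2 s * G1 s) * ?I12 + (F2 s * G2 s) * ?I11 \<le> 0" (is "?J s \<le> 0") for s
  proof -
    let ?H = "\<lambda>t. (F1 s * G1 s) * (F2 t * G2 t) - (F1 s * G2 s) * (F2 t * G1 t)
                - (F2 s * G1 s) * (F1 t * G2 t) + (F2 s * G2 s) * (F1 t * G1 t)"
    have "?H t = (F1 s * F2 t - F1 t * F2 s) * (G1 s * G2 t - G1 t * G2 s)" for t
      by (simp add: algebra_simps)
    then have "?H t \<le> 0" for t using sign[of s t] by metis
    then have "integral\<^sup>L N ?H \<le> integral\<^sup>L N (\<lambda>_. 0)"
      by (intro integral_mono) auto
    moreover have "integral\<^sup>L N ?H = ?J s" by simp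
    ultimately show ?thesis by simp
  qed
  have "integral\<^sup>L N ?J \<le> integral\<^sup>L N (\<lambda>_. 0)"
    using inner by (intro integral_mono) auto
  moreover have "integral\<^sup>L N ?J = 2 * (?I11 * ?I22 - ?I12 * ?I21)"
    by simp
  ultimately show ?thesis by simp
qed

text \<open>Shifting a normal density to the right by \<open>e\<close> multiplies it by an increasing function.\<close>

lemma normal_density_likelihood_ratio:
  assumes "0 \<le> e" "z \<le> w"
  shows "normal_density e s z * normal_density 0 s w \<le> normal_density 0 s z * normal_density e s w"
proof -
  have prod: "normal_density a s p * normal_density b s q
      = (1 / sqrt (2 * pi * s\<^sup>2))\<^sup>2 * exp (- ((p - a)\<^sup>2 + (q - b)\<^sup>2) / (2 * s\<^sup>2))" for a b p q
  proof -
    have "- (p - a)\<^sup>2 / (2 * s\<^sup>2) + - (q - b)\<^sup>2 / (2 * s\<^sup>2) = - ((p - a)\<^sup>2 + (q - b)\<^sup>2) / (2 * s\<^sup>2)"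
      by argo
    then show ?thesis
      by (simp add: normal_density_def power2_eq_square[of "1 / _"] flip: exp_add)
  qed
  have "(z - 0)\<^sup>2 + (w - e)\<^sup>2 \<le> (z - e)\<^sup>2 + (w - 0)\<^sup>2"
    using mult_left_mono[OF assms(2,1)] by (simp add: power2_eq_square algebra_simps)
  then have "exp (- ((z - e)\<^sup>2 + (w - 0)\<^sup>2) / (2 * s\<^sup>2)) \<le> exp (- ((z - 0)\<^sup>2 + (w - e)\<^sup>2) / (2 * s\<^sup>2))"
    by (simp add: divide_right_mono)
  then show ?thesis
    unfolding prod by (intro mult_left_mono) auto
qed

text \<open>This is the one-dimensional case of the theorem of Prekopa for a Gaussian kernel. A shift of the
  argument by \<open>e\<close> is moved onto the density; then the determinants of the shifts of \<open>f\<close> have one sign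
  by log-concavity and those of the two densities the opposite sign by the likelihood ratio.\<close>

lemma log_concave_gauss_mean:
  assumes f: "mono_unit f" "log_concave f" and s: "0 < s"
  shows "log_concave (gauss_mean s f)"
  unfolding log_concave_def
proof (intro allI impI)
  fix x d e :: real
  assume d: "0 \<le> d" and e: "0 \<le> e"
  let ?F1 = "\<lambda>z. f (x + z)" and ?F2 = "\<lambda>z. f (x + d + z)"
  let ?G1 = "normal_density 0 s" and ?G2 = "normal_density e s"
  have F: "?F1 z * ?F2 w \<le> ?F1 w * ?F2 z" if "z \<le> w" for z w
    using f(2)[unfolded log_concave_def, rule_format, of d "w - z" "x + z"] d that by (simp add: algebra_simps)
  have G: "?G1 w * ?G2 z \<le> ?G1 z * ?G2 w" if "z \<le> w" for z w
    using normal_density_likelihood_ratio[OF e that, of s] by (simp add: mult.commute)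
  have sign: "(?F1 z * ?F2 w - ?F1 w * ?F2 z) * (?G1 z * ?G2 w - ?G1 w * ?G2 z) \<le> 0" for z w
    using F[of z w] G[of z w] F[of w z] G[of w z]
    by (cases "z \<le> w") (auto simp: mult_le_0_iff)
  have "gauss_mean s f x * gauss_mean s f (x + d + e) \<le> gauss_mean s f (x + e) * gauss_mean s f (x + d)"
    unfolding gauss_mean_shift[OF s, of f x e] gauss_mean_shift[OF s, of f "x + d" e]
    unfolding gauss_mean_def
    by (rule integral_product_exchange[OF _ _ _ _ sign])
       (intro integrable_mono_unit_times_normal[OF f(1) s])+
  then show "gauss_mean s f x * gauss_mean s f (x + d + e) \<le> gauss_mean s f (x + d) * gauss_mean s f (x + e)"
    by (simp add: mult.commute)
qed

lemma concave_decreasing_increments: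
  fixes \<phi> :: "real \<Rightarrow> real"
  assumes conc: "concave_on UNIV \<phi>" and "0 \<le> d" "0 \<le> e"
  shows "\<phi> x + \<phi> (x + d + e) \<le> \<phi> (x + d) + \<phi> (x + e)"
proof (cases "d + e = 0")
  case True
  then show ?thesis using assms by (simp add: add_nonneg_eq_0_iff)
next
  case False
  \<comment> \<open>the two middle points are convex combinations of the outer ones, with exchanged weights\<close>
  define p where "p = d / (d + e)"
  have p: "0 \<le> p" "p \<le> 1" "p * (d + e) = d" using False assms by (auto simp: p_def field_simps)
  have "(1 - p) * \<phi> x + p * \<phi> (x + d + e) \<le> \<phi> ((1 - p) *\<^sub>R x + p *\<^sub>R (x + d + e))"
    by (rule concave_onD[OF conc]) (use p in auto)
  also have "(1 - p) *\<^sub>R x + p *\<^sub>R (x + d + e) = x + d"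
  proof -
    have "(1 - p) *\<^sub>R x + p *\<^sub>R (x + d + e) = x + p * (d + e)" by (simp add: algebra_simps)
    then show ?thesis by (simp only: p(3))
  qed
  finally have 1: "(1 - p) * \<phi> x + p * \<phi> (x + d + e) \<le> \<phi> (x + d)" .
  have "(1 - (1 - p)) * \<phi> x + (1 - p) * \<phi> (x + d + e) \<le> \<phi> ((1 - (1 - p)) *\<^sub>R x + (1 - p) *\<^sub>R (x + d + e))"
    by (rule concave_onD[OF conc]) (use p in auto)
  also have "(1 - (1 - p)) *\<^sub>R x + (1 - p) *\<^sub>R (x + d + e) = x + e"
  proof -
    have "(1 - (1 - p)) *\<^sub>R x + (1 - p) *\<^sub>R (x + d + e) = x + (d + e) - p * (d + e)"
      by (simp add: algebra_simps)
    then show ?thesis by (simp add: p(3))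
  qed
  finally have 2: "(1 - (1 - p)) * \<phi> x + (1 - p) * \<phi> (x + d + e) \<le> \<phi> (x + e)" .
  have "((1 - p) * \<phi> x + p * \<phi> (x + d + e)) + ((1 - (1 - p)) * \<phi> x + (1 - p) * \<phi> (x + d + e))
      = \<phi> x + \<phi> (x + d + e)"
    by (simp add: algebra_simps)
  then show ?thesis using 1 2 by linarith
qed

text \<open>Concavity of \<open>\<phi>\<close> makes the fourth point lie to the left of where an additive \<open>\<phi>\<close> would put it,
  and \<open>f\<close> is increasing.\<close>

lemma log_concave_comp_concave:
  assumes f: "mono_unit f" "log_concave f" and \<phi>: "mono \<phi>" "concave_on UNIV \<phi>"
  shows "log_concave (\<lambda>y. f (\<phi> y))"
  unfolding log_concave_def
proof (intro allI impI)
  fix x d e :: real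
  assume d: "0 \<le> d" and e: "0 \<le> e"
  define d' e' where "d' = \<phi> (x + d) - \<phi> x" and "e' = \<phi> (x + e) - \<phi> x"
  have "0 \<le> d'" "0 \<le> e'" using \<phi>(1) d e by (auto simp: d'_def e'_def mono_def)
  then have "f (\<phi> x) * f (\<phi> x + d' + e') \<le> f (\<phi> x + d') * f (\<phi> x + e')"
    using f(2) by (simp add: log_concave_def)
  moreover have "\<phi> (x + d + e) \<le> \<phi> x + d' + e'"
    using concave_decreasing_increments[OF \<phi>(2) d e, of x] by (simp add: d'_def e'_def)
  then have "f (\<phi> x) * f (\<phi> (x + d + e)) \<le> f (\<phi> x) * f (\<phi> x + d' + e')"
    using f(1) by (intro mult_left_mono) (auto simp: mono_unit_def mono_def)
  ultimately show "f (\<phi> x) * f (\<phi> (x + d + e)) \<le> f (\<phi> (x + d)) * f (\<phi> (x + e))"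
    by (simp add: d'_def e'_def)
qed

section \<open>A Harnack inequality for Gaussian averages\<close>

text \<open>Moving the centre of the Gaussian costs a likelihood ratio \<open>r\<close>, whose second moment is
  \<open>exp (\<kappa>\<^sup>2 / s\<^sup>2)\<close>; the rest is the Cauchy--Schwarz inequality.\<close>

lemma gauss_mean_harnack:
  assumes f: "mono_unit f" and s: "0 < s"
  shows "(gauss_mean s f (m + \<kappa>))\<^sup>2 \<le> exp (\<kappa>\<^sup>2 / s\<^sup>2) * gauss_mean s (\<lambda>z. (f z)\<^sup>2) m"
proof -
  let ?g = "normal_density 0 s"
  define r where "r z = exp ((2 * \<kappa> * z - \<kappa>\<^sup>2) / (2 * s\<^sup>2))" for z :: real
  define R where "R = exp (\<kappa>\<^sup>2 / s\<^sup>2)"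
  define I where "I = gauss_mean s f (m + \<kappa>)"
  define a where "a = gauss_mean s (\<lambda>z. (f z)\<^sup>2) m"
  have rg: "r z * ?g z = normal_density \<kappa> s z" for z
  proof -
    have "(2 * \<kappa> * z - \<kappa>\<^sup>2) / (2 * s\<^sup>2) + - z\<^sup>2 / (2 * s\<^sup>2) = - (z - \<kappa>)\<^sup>2 / (2 * s\<^sup>2)"
      by (simp add: power2_eq_square algebra_simps flip: add_divide_distrib diff_divide_distrib)
    then show ?thesis by (simp add: r_def normal_density_def flip: exp_add)
  qed
  have rrg: "(r z)\<^sup>2 * ?g z = R * normal_density (2 * \<kappa>) s z" for z
  proof -
    have "2 * ((2 * \<kappa> * z - \<kappa>\<^sup>2) / (2 * s\<^sup>2)) + - z\<^sup>2 / (2 * s\<^sup>2)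
        = \<kappa>\<^sup>2 / s\<^sup>2 + - (z - 2 * \<kappa>)\<^sup>2 / (2 * s\<^sup>2)"
      using s by (simp add: field_simps power2_eq_square)
    then have "exp ((2 * \<kappa> * z - \<kappa>\<^sup>2) / (2 * s\<^sup>2)) ^ 2 * exp (- z\<^sup>2 / (2 * s\<^sup>2))
        = exp (\<kappa>\<^sup>2 / s\<^sup>2) * exp (- (z - 2 * \<kappa>)\<^sup>2 / (2 * s\<^sup>2))"
      by (simp only: exp_double[symmetric] exp_add[symmetric])
    then show ?thesis by (simp add: r_def R_def normal_density_def)
  qed
  have ff: "mono_unit (\<lambda>z. (f z)\<^sup>2)"
    using f by (auto simp: mono_unit_def mono_def power_le_one intro!: power_mono)
  have int1: "integrable lborel (\<lambda>z. (f (m + z))\<^sup>2 * ?g z)"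
    using integrable_mono_unit_times_normal[OF ff s] by simp
  have int2: "integrable lborel (\<lambda>z. f (m + z) * normal_density \<kappa> s z)"
    using integrable_mono_unit_times_normal[OF f s] .
  have eq: "(R * f (m + z) - I * r z)\<^sup>2 * ?g z
      = R\<^sup>2 * ((f (m + z))\<^sup>2 * ?g z) - 2 * R * I * (f (m + z) * normal_density \<kappa> s z)
        + I\<^sup>2 * R * normal_density (2 * \<kappa>) s z" for z
  proof -
    have "(R * f (m + z) - I * r z)\<^sup>2 * ?g z = R\<^sup>2 * ((f (m + z))\<^sup>2 * ?g z)
        - 2 * R * I * (f (m + z) * (r z * ?g z)) + I\<^sup>2 * ((r z)\<^sup>2 * ?g z)"
      by (simp add: power2_eq_square algebra_simps)
    then show ?thesis by (simp only: rg rrg mult.assoc)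
  qed
  \<comment> \<open>\<open>I / R * r\<close> is the projection of the shifted \<open>f\<close> onto the multiples of \<open>r\<close>\<close>
  have "0 \<le> (\<integral>z. (R * f (m + z) - I * r z)\<^sup>2 * ?g z \<partial>lborel)"
    by (intro integral_nonneg_AE) auto
  also have "\<dots> = R\<^sup>2 * a - 2 * R * I * I + I\<^sup>2 * R"
    unfolding eq using int1 int2 s gauss_mean_shift[OF s, of f m \<kappa>]
    by (simp add: a_def I_def gauss_mean_def[of s "\<lambda>z. (f z)\<^sup>2"])
  also have "\<dots> = R * (R * a - I\<^sup>2)" by (simp add: power2_eq_square algebra_simps)
  finally have "I\<^sup>2 \<le> R * a"
    by (simp add: zero_le_mult_iff R_def)
  then show ?thesis by (simp add: I_def R_def a_def)
qed

section \<open>The backward recursion\<close>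

text \<open>For the recursion that applies \<open>\<phi> k\<close> at time \<open>k\<close> and adds centred Gaussian noise of deviation
  \<open>s\<close>, this is the probability to exceed \<open>x\<close> when \<open>j\<close> steps remain after time \<open>k\<close>.\<close>

primrec tail_prob ::
  "(nat \<Rightarrow> real \<Rightarrow> real) \<Rightarrow> real \<Rightarrow> real \<Rightarrow> nat \<Rightarrow> nat \<Rightarrow> real \<Rightarrow> real" where
  "tail_prob \<phi> s x 0 k = indicator {x<..}"
| "tail_prob \<phi> s x (Suc j) k = (\<lambda>y. gauss_mean s (tail_prob \<phi> s x j (Suc k)) (\<phi> k y))"

lemma mono_unit_tail_prob:
  assumes "\<And>k. mono (\<phi> k)" "0 < s"
  shows "mono_unit (tail_prob \<phi> s x j k)"
proof (induction j arbitrary: k)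
  case 0
  then show ?case by (auto simp: mono_unit_def mono_def indicator_def)
next
  case (Suc j)
  have "mono_unit (gauss_mean s (tail_prob \<phi> s x j (Suc k)))"
    by (rule mono_unit_gauss_mean[OF Suc.IH assms(2)])
  then show ?case using assms(1) by (auto simp: mono_unit_def mono_def)
qed

lemma log_concave_tail_prob:
  assumes "\<And>k. mono (\<phi> k)" "\<And>k. concave_on UNIV (\<phi> k)" "0 < s"
  shows "log_concave (tail_prob \<phi> s x j k)"
proof (induction j arbitrary: k)
  case 0
  then show ?case by (auto simp: log_concave_def indicator_def)
next
  case (Suc j)
  have V: "mono_unit (tail_prob \<phi> s x j (Suc k))"
    by (rule mono_unit_tail_prob[OF assms(1,3)])
  show ?case
    unfolding tail_prob.simps
    by (rule log_concave_comp_concave[OF mono_unit_gauss_mean[OF V assms(3)]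
          log_concave_gauss_mean[OF V Suc.IH assms(3)] assms(1,2)])
qed

text \<open>A start at distance \<open>j * \<eta>\<close> is compensated by lowering the distance by \<open>\<eta>\<close> at each of the \<open>j\<close>
  remaining steps. Every step then pays for one shift of its noise, by at most
  \<open>\<eta> * (1 + L * n)\<close>. With \<open>\<eta>\<close>, \<open>L\<close> and \<open>s\<^sup>2\<close> all of order \<open>1 / n\<close> the total cost stays bounded as
  the steps become finer.\<close>

lemma tail_prob_harnack:
  assumes mono: "\<And>k. mono (\<phi> k)" and s: "0 < s"
    and lip: "\<And>k y d. 0 \<le> d \<Longrightarrow> \<phi> k (y + d) \<le> \<phi> k y + (1 + L) * d"
    and L: "0 \<le> L" "0 \<le> \<eta>"
    and j: "j \<le> n"
  shows "(tail_prob \<phi> s x j k (y + j * \<eta>))\<^sup>2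
      \<le> exp (j * ((\<eta> * (1 + L * n))\<^sup>2 / s\<^sup>2)) * tail_prob \<phi> s x j k y"
  using j
proof (induction j arbitrary: k y)
  case 0
  then show ?case by (simp add: indicator_def)
next
  case (Suc j)
  define \<kappa> where "\<kappa> = \<eta> * (1 + L * n)"
  let ?V = "tail_prob \<phi> s x j (Suc k)"
  let ?E = "exp (j * (\<kappa>\<^sup>2 / s\<^sup>2))"
  let ?m = "\<phi> k y + j * \<eta>"
  have V: "mono_unit ?V" by (rule mono_unit_tail_prob[OF mono s])
  note GV = mono_unit_gauss_mean[OF V s]
  have "\<phi> k (y + Suc j * \<eta>) \<le> \<phi> k y + (1 + L) * (Suc j * \<eta>)"
    using L by (intro lip) auto
  also have "L * (Suc j * \<eta>) \<le> L * (n * \<eta>)"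
    using Suc.prems L by (intro mult_left_mono mult_right_mono) auto
  then have "\<phi> k y + (1 + L) * (Suc j * \<eta>) \<le> ?m + \<kappa>"
    by (simp add: \<kappa>_def algebra_simps)
  finally have "tail_prob \<phi> s x (Suc j) k (y + Suc j * \<eta>) \<le> gauss_mean s ?V (?m + \<kappa>)"
    using GV by (simp add: mono_unit_def mono_def)
  then have "(tail_prob \<phi> s x (Suc j) k (y + Suc j * \<eta>))\<^sup>2 \<le> (gauss_mean s ?V (?m + \<kappa>))\<^sup>2"
    using GV by (intro power_mono) (auto simp: mono_unit_def)
  also have "\<dots> \<le> exp (\<kappa>\<^sup>2 / s\<^sup>2) * gauss_mean s (\<lambda>z. (?V z)\<^sup>2) ?m"
    by (rule gauss_mean_harnack[OF V s])
  also have "gauss_mean s (\<lambda>z. (?V z)\<^sup>2) ?m \<le> ?E * gauss_mean s ?V (\<phi> k y)"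
  proof -
    have VV: "mono_unit (\<lambda>z. (?V z)\<^sup>2)"
      using V by (auto simp: mono_unit_def mono_def power_le_one intro!: power_mono)
    have "gauss_mean s (\<lambda>z. (?V z)\<^sup>2) ?m
        \<le> (\<integral>z. ?E * (?V (\<phi> k y + z) * normal_density 0 s z) \<partial>lborel)"
      unfolding gauss_mean_def
    proof (intro integral_mono)
      show "integrable lborel (\<lambda>z. (?V (?m + z))\<^sup>2 * normal_density 0 s z)"
        using integrable_mono_unit_times_normal[OF VV s] by simp
      show "integrable lborel (\<lambda>z. ?E * (?V (\<phi> k y + z) * normal_density 0 s z))"
        using integrable_mono_unit_times_normal[OF V s] by simp
      show "(?V (?m + z))\<^sup>2 * normal_density 0 s z \<le> ?E * (?V (\<phi> k y + z) * normal_density 0 s z)" for z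
        using mult_right_mono[OF Suc.IH[of "Suc k" "\<phi> k y + z"], of "normal_density 0 s z"] Suc.prems
        by (simp add: \<kappa>_def algebra_simps)
    qed
    then show ?thesis by (simp add: gauss_mean_def)
  qed
  also have "exp (\<kappa>\<^sup>2 / s\<^sup>2) * (?E * gauss_mean s ?V (\<phi> k y))
      = exp (Suc j * (\<kappa>\<^sup>2 / s\<^sup>2)) * tail_prob \<phi> s x (Suc j) k y"
  proof -
    have "real (Suc j) * (\<kappa>\<^sup>2 / s\<^sup>2) = \<kappa>\<^sup>2 / s\<^sup>2 + j * (\<kappa>\<^sup>2 / s\<^sup>2)"
      by (simp only: of_nat_Suc) argo
    then show ?thesis by (simp only: exp_add tail_prob.simps mult.assoc)
  qed
  finally show ?case by (simp add: \<kappa>_def mult_left_mono)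
qed

section \<open>From midpoint convexity to convexity\<close>

text \<open>Midpoints give the chord inequality at dyadic points. Any point of a segment is approached
  by dyadic points on its left, where an antimonotone function is larger; so no continuity has to be
  known beforehand.\<close>

lemma convex_on_midpoint_antimono:
  fixes f :: "real \<Rightarrow> real"
  assumes anti: "antimono f" and mid: "\<And>a b. f ((a + b) / 2) \<le> (f a + f b) / 2"
  shows "convex_on UNIV f"
proof (rule convex_on_linorderI)
  fix p a b :: real
  assume p: "0 < p" "p < 1" and "a < b"
  have dyadic: "f (a + k / 2 ^ n * (b - a)) \<le> f a + k / 2 ^ n * (f b - f a)" if "k \<le> 2 ^ n" for n k :: nat
    using that
  proof (induction n arbitrary: k)
    case 0
    then have "k = 0 \<or> k = 1" by auto
    then show ?case by auto
  next
    case (Suc n)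
    show ?case
    proof (cases "k \<le> 2 ^ n")
      case True
      have "a + k / 2 ^ Suc n * (b - a) = (a + (a + k / 2 ^ n * (b - a))) / 2"
        by (simp add: field_simps)
      also have "f \<dots> \<le> (f a + f (a + k / 2 ^ n * (b - a))) / 2" by (rule mid)
      also have "\<dots> \<le> (f a + (f a + k / 2 ^ n * (f b - f a))) / 2"
        using Suc.IH[OF True] by argo
      also have "\<dots> = f a + k / 2 ^ Suc n * (f b - f a)" by (simp add: field_simps)
      finally show ?thesis .
    next
      case False
      define l where "l = k - 2 ^ n"
      have k: "k = 2 ^ n + l" and l: "l \<le> 2 ^ n"
        using False Suc.prems by (auto simp: l_def)
      have affine: "a + (1 + q) / 2 * (b - a) = (b + (a + q * (b - a))) / 2"
          "(f b + (f a + q * (f b - f a))) / 2 = f a + (1 + q) / 2 * (f b - f a)" for q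
        by (simp_all add: field_simps)
      have half: "real k / 2 ^ Suc n = (1 + l / 2 ^ n) / 2"
        by (simp add: k field_simps)
      have "a + k / 2 ^ Suc n * (b - a) = (b + (a + l / 2 ^ n * (b - a))) / 2"
        unfolding half by (rule affine)
      also have "f \<dots> \<le> (f b + f (a + l / 2 ^ n * (b - a))) / 2" by (rule mid)
      also have "\<dots> \<le> (f b + (f a + l / 2 ^ n * (f b - f a))) / 2"
        using Suc.IH[OF l] by argo
      also have "\<dots> = f a + k / 2 ^ Suc n * (f b - f a)"
        unfolding half by (rule affine)
      finally show ?thesis .
    qed
  qed
  define k where "k n = nat \<lfloor>p * 2 ^ n\<rfloor>" for n :: nat
  define q where "q n = real (k n) / 2 ^ n" for n
  have kr: "real (k n) \<le> p * 2 ^ n" "p * 2 ^ n - 1 \<le> real (k n)" for n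
    using p by (auto simp: k_def intro!: of_int_floor_le)
  have q_le: "q n \<le> p" "p - (1 / 2) ^ n \<le> q n" for n
    using divide_right_mono[OF kr(1)[of n], of "2 ^ n"] divide_right_mono[OF kr(2)[of n], of "2 ^ n"]
    by (auto simp: q_def diff_divide_distrib power_one_over)
  have "k n \<le> 2 ^ n" for n
  proof -
    have "real (k n) \<le> 2 ^ n" using kr(1)[of n] p by (smt (verit) mult_left_le_one_le zero_le_power)
    then show ?thesis by (metis of_nat_le_iff of_nat_numeral of_nat_power)
  qed
  then have le: "f (a + p * (b - a)) \<le> f a + q n * (f b - f a)" for n
    using dyadic[of "k n" n] q_le(1)[of n] \<open>a < b\<close> anti
    unfolding q_def[symmetric] monotone_def
    by (smt (verit, best) mult_right_mono)
  have "(\<lambda>n. p - (1 / 2) ^ n) \<longlonglongrightarrow> p - 0" by (intro tendsto_intros LIMSEQ_power_zero) auto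
  then have "q \<longlonglongrightarrow> p"
    using q_le by (intro tendsto_sandwich[of "\<lambda>n. p - (1 / 2) ^ n" q _ "\<lambda>_. p"]) auto
  then have "(\<lambda>n. f a + q n * (f b - f a)) \<longlonglongrightarrow> f a + p * (f b - f a)"
    by (intro tendsto_intros)
  then have "f (a + p * (b - a)) \<le> f a + p * (f b - f a)"
    by (rule LIMSEQ_le_const) (use le in auto)
  then show "f ((1 - p) *\<^sub>R a + p *\<^sub>R b) \<le> (1 - p) * f a + p * f b"
    by (simp add: algebra_simps)
qed simp

section \<open>Recursions driven by independent Gaussian noise\<close>

primrec chain :: "(nat \<Rightarrow> real \<Rightarrow> real) \<Rightarrow> (nat \<Rightarrow> real) \<Rightarrow> real \<Rightarrow> nat \<Rightarrow> real" where
  "chain \<phi> \<xi> y 0 = y"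
| "chain \<phi> \<xi> y (Suc k) = \<phi> k (chain \<phi> \<xi> y k) + \<xi> k"

lemma chain_restrict: "{..<k} \<subseteq> I \<Longrightarrow> chain \<phi> (restrict \<xi> I) y k = chain \<phi> \<xi> y k"
  by (induction k) (auto simp: subset_eq)

lemma measurable_chain:
  assumes "\<And>k. \<phi> k \<in> borel_measurable borel" and "\<And>i. i < k \<Longrightarrow> \<xi> i \<in> borel_measurable N"
  shows "(\<lambda>\<omega>. chain \<phi> (\<lambda>i. \<xi> i \<omega>) y k) \<in> borel_measurable N"
  using assms(2)
proof (induction k)
  case (Suc k)
  note [measurable] = assms(1)
  have [measurable]: "(\<lambda>\<omega>. chain \<phi> (\<lambda>i. \<xi> i \<omega>) y k) \<in> borel_measurable N" "\<xi> k \<in> borel_measurable N"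
    using Suc by auto
  show ?case by simp
qed simp

lemma (in prob_space) expectation_gauss_mean:
  assumes ind: "indep_var borel Z borel X"
    and X: "distributed M lborel X (normal_density 0 s)" and s: "0 < s"
    and f: "mono_unit f"
  shows "expectation (\<lambda>\<omega>. f (Z \<omega> + X \<omega>)) = expectation (\<lambda>\<omega>. gauss_mean s f (Z \<omega>))"
proof -
  note [measurable] = measurable_mono_unit[OF f] indep_var_rv1[OF ind] indep_var_rv2[OF ind]
    measurable_mono_unit[OF mono_unit_gauss_mean[OF f s]]
  have joint: "distr M borel Z \<Otimes>\<^sub>M distr M borel X = distr M (borel \<Otimes>\<^sub>M borel) (\<lambda>\<omega>. (Z \<omega>, X \<omega>))"
    using ind unfolding indep_var_distribution_eq by simp
  interpret Z: prob_space "distr M borel Z" by (rule prob_space_distr) simp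
  interpret X: prob_space "distr M borel X" by (rule prob_space_distr) simp
  interpret P: pair_prob_space "distr M borel Z" "distr M borel X" ..
  have int: "integrable (distr M borel Z \<Otimes>\<^sub>M distr M borel X) (\<lambda>p. f (fst p + snd p))"
    by (rule P.P.integrable_const_bound[where B = 1]) (use f in \<open>auto simp: mono_unit_def\<close>)
  have inner: "(\<integral>x. f (z + x) \<partial>distr M borel X) = gauss_mean s f z" for z
  proof -
    have "(\<integral>x. f (z + x) \<partial>distr M borel X) = expectation (\<lambda>\<omega>. f (z + X \<omega>))"
      by (subst integral_distr) auto
    also have "\<dots> = (\<integral>x. normal_density 0 s x * f (z + x) \<partial>lborel)"
      by (subst distributed_integral[OF X, symmetric]) auto
    finally show ?thesis by (simp add: gauss_mean_def mult.commute)
  qed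
  have "expectation (\<lambda>\<omega>. f (Z \<omega> + X \<omega>))
      = (\<integral>p. f (fst p + snd p) \<partial>distr M (borel \<Otimes>\<^sub>M borel) (\<lambda>\<omega>. (Z \<omega>, X \<omega>)))"
    by (subst integral_distr) auto
  also have "\<dots> = (\<integral>z. (\<integral>x. f (z + x) \<partial>distr M borel X) \<partial>distr M borel Z)"
    unfolding joint[symmetric] using P.integral_fst'[OF int] by simp
  also have "\<dots> = expectation (\<lambda>\<omega>. gauss_mean s f (Z \<omega>))"
    unfolding inner by (subst integral_distr) auto
  finally show ?thesis .
qed

text \<open>The state after \<open>k\<close> steps depends on the first \<open>k\<close> noise variables only and is independent of the
  next one. Hence averaging over one noise variable after the other is the backward recursion.\<close>

lemma (in prob_space) tail_prob_chain:
  assumes ind: "indep_vars (\<lambda>_. borel) \<xi> {..<n}"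
    and normal: "\<And>k. k < n \<Longrightarrow> distributed M lborel (\<xi> k) (normal_density 0 s)" and s: "0 < s"
    and mono: "\<And>k. mono (\<phi> k)"
  shows "prob {\<omega> \<in> space M. x < chain \<phi> (\<lambda>i. \<xi> i \<omega>) y n} = tail_prob \<phi> s x n 0 y"
proof -
  let ?C = "\<lambda>k \<omega>. chain \<phi> (\<lambda>i. \<xi> i \<omega>) y k"
  have \<xi> [measurable]: "random_variable borel (\<xi> k)" if "k < n" for k
    using ind that by (auto simp: indep_vars_def)
  have \<phi>: "\<phi> k \<in> borel_measurable borel" for k
    using mono by (rule borel_measurable_mono)
  have C: "random_variable borel (?C k)" if "k \<le> n" for k
    using that by (intro measurable_chain \<phi> \<xi>) simp
  have step: "expectation (\<lambda>\<omega>. tail_prob \<phi> s x j k (?C k \<omega>))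
      = expectation (\<lambda>\<omega>. indicator {x<..} (?C n \<omega>))" if "k + j = n" for j k
    using that
  proof (induction j arbitrary: k)
    case 0
    then show ?case by simp
  next
    case (Suc j)
    then have k: "k < n" by simp
    have "indep_var (Pi\<^sub>M {..<k} (\<lambda>_. borel)) (\<lambda>\<omega>. \<lambda>i\<in>{..<k}. \<xi> i \<omega>)
        (Pi\<^sub>M {k} (\<lambda>_. borel)) (\<lambda>\<omega>. \<lambda>i\<in>{k}. \<xi> i \<omega>)"
      by (rule indep_var_restrict[OF ind]) (use k in auto)
    from indep_var_compose[OF this, of "\<lambda>v. \<phi> k (chain \<phi> v y k)" borel "\<lambda>v. v k" borel]
    have "indep_var borel (\<lambda>\<omega>. \<phi> k (?C k \<omega>)) borel (\<xi> k)"
      by (simp add: comp_def chain_restrict measurable_compose[OF measurable_chain[OF \<phi>] \<phi>])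
    from expectation_gauss_mean[OF this normal[OF k] s 
        mono_unit_tail_prob[where x = x and j = j and k = "Suc k", OF mono s]]
    have "expectation (\<lambda>\<omega>. tail_prob \<phi> s x (Suc j) k (?C k \<omega>))
        = expectation (\<lambda>\<omega>. tail_prob \<phi> s x j (Suc k) (?C (Suc k) \<omega>))"
      by simp
    also have "\<dots> = expectation (\<lambda>\<omega>. indicator {x<..} (?C n \<omega>))"
      using Suc.prems by (intro Suc.IH) simp
    finally show ?case .
  qed
  have "tail_prob \<phi> s x n 0 y = expectation (\<lambda>\<omega>. tail_prob \<phi> s x n 0 (?C 0 \<omega>))"
    by (simp add: prob_space)
  also have "\<dots> = expectation (\<lambda>\<omega>. indicator {x<..} (?C n \<omega>))" by (rule step) simp
  also have "\<dots> = expectation (indicator {\<omega> \<in> space M. x < ?C n \<omega>})"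
    by (intro Bochner_Integration.integral_cong) (auto simp: indicator_def)
  also have "\<dots> = prob {\<omega> \<in> space M. x < ?C n \<omega>}"
    using C[of n] by simp
  finally show ?thesis by simp
qed

lemma chain_gap:
  assumes gap: "\<And>k y d. 0 \<le> d \<Longrightarrow> \<phi> k y + c * d \<le> \<phi> k (y + d)" and c: "0 \<le> c" and d: "0 \<le> d"
  shows "chain \<phi> \<xi> y k + c ^ k * d \<le> chain \<phi> \<xi> (y + d) k"
proof (induction k)
  case 0
  then show ?case by simp
next
  case (Suc k)
  define e where "e = chain \<phi> \<xi> (y + d) k - chain \<phi> \<xi> y k"
  have e: "c ^ k * d \<le> e" using Suc.IH by (simp add: e_def)
  moreover have "0 \<le> c ^ k * d" using c d by simp
  ultimately have "\<phi> k (chain \<phi> \<xi> y k) + c * e \<le> \<phi> k (chain \<phi> \<xi> y k + e)"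
    by (intro gap) simp
  moreover have "c * (c ^ k * d) \<le> c * e" by (rule mult_left_mono[OF e c])
  ultimately show ?case by (simp add: e_def mult.assoc)
qed

section \<open>Pathwise convergence of the Euler scheme\<close>

definition grid :: "real \<Rightarrow> real \<Rightarrow> nat \<Rightarrow> nat \<Rightarrow> real" where
  "grid t T n k = t + real k * ((T - t) / real n)"

text \<open>The time is cut off at \<open>T\<close> so that every \<open>k\<close>, not only \<open>k \<le> n\<close>, evaluates the drift where it is
  controlled.\<close>

definition euler_map :: "(real \<Rightarrow> real \<Rightarrow> real) \<Rightarrow> real \<Rightarrow> real \<Rightarrow> nat \<Rightarrow> nat \<Rightarrow> real \<Rightarrow> real" where
  "euler_map b t T n k y = y + (T - t) / real n * b y (min T (grid t T n k))"

definition increment :: "(real \<Rightarrow> real) \<Rightarrow> real \<Rightarrow> real \<Rightarrow> nat \<Rightarrow> nat \<Rightarrow> real" where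
  "increment w t T n k = w (grid t T n (Suc k)) - w (grid t T n k)"

lemma grid_mem: "t < T \<Longrightarrow> k \<le> n \<Longrightarrow> grid t T n k \<in> {t..T}"
  using mult_right_mono[of "real k" "real n" "(T - t) / real n"]
  by (cases "n = 0") (auto simp: grid_def)

lemma grid_last: "0 < n \<Longrightarrow> grid t T n n = T"
  by (simp add: grid_def)

lemma grid_Suc: "grid t T n (Suc k) = grid t T n k + (T - t) / real n"
  by (simp add: grid_def algebra_simps add_divide_distrib diff_divide_distrib)

text \<open>The noise is additive, so it cancels from the error. What remains per step is the amplification
  \<open>1 + h * A\<close> by the Lipschitz drift and the oscillation of the drift along the solution.\<close>

lemma euler_error:
  fixes X w :: "real \<Rightarrow> real"
  assumes tT: "t < T" and A: "0 \<le> A" and n: "0 < n"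
    and lip: "\<And>y z s. s \<le> T \<Longrightarrow> \<bar>b y s - b z s\<bar> \<le> A * \<bar>y - z\<bar>"
    and cont: "continuous_on {t..T} (\<lambda>r. b (X r) r)"
    and X: "\<And>s. s \<in> {t..T} \<Longrightarrow> X s = y + integral {t..s} (\<lambda>r. b (X r) r) + (w s - w t)"
    and osc: "\<And>r r'. r \<in> {t..T} \<Longrightarrow> r' \<in> {t..T} \<Longrightarrow> \<bar>r - r'\<bar> \<le> (T - t) / n
        \<Longrightarrow> \<bar>b (X r) r - b (X r') r'\<bar> \<le> \<eta>"
  shows "\<bar>X T - chain (euler_map b t T n) (increment w t T n) y n\<bar> \<le> (T - t) * \<eta> * exp (A * (T - t))"
proof -
  define h where "h = (T - t) / n"
  have h: "0 < h" "n * h = T - t" using tT n by (auto simp: h_def)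
  let ?g = "grid t T n" and ?\<beta> = "\<lambda>r. b (X r) r"
  let ?E = "chain (euler_map b t T n) (increment w t T n) y"
  have eta: "0 \<le> \<eta>" using osc[of t t] tT h(1) by (simp add: h_def)
  have error: "\<bar>X (?g k) - ?E k\<bar> \<le> k * h * \<eta> * (1 + h * A) ^ k" if "k \<le> n" for k
    using that
  proof (induction k)
    case 0
    then show ?case using X[of t] tT by (simp add: grid_def)
  next
    case (Suc k)
    let ?e = "\<bar>X (?g k) - ?E k\<bar>"
    have gk: "?g k \<in> {t..T}" "?g (Suc k) \<in> {t..T}"
      using Suc.prems by (auto intro!: grid_mem[OF tT] simp del: atLeastAtMost_iff)
    have gS: "?g (Suc k) = ?g k + h" by (simp add: grid_Suc h_def)
    have int: "?\<beta> integrable_on {t..?g (Suc k)}"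
      using gk by (intro integrable_continuous_real continuous_on_subset[OF cont]) auto
    have cont_k: "continuous_on {?g k..?g (Suc k)} ?\<beta>"
      using gk by (intro continuous_on_subset[OF cont]) auto
    have "integral {t..?g k} ?\<beta> + integral {?g k..?g (Suc k)} ?\<beta> = integral {t..?g (Suc k)} ?\<beta>"
      using gk h(1) gS int by (intro Henstock_Kurzweil_Integration.integral_combine) auto
    then have XS: "X (?g (Suc k)) = X (?g k) + integral {?g k..?g (Suc k)} ?\<beta> + increment w t T n k"
      using X[OF gk(1)] X[OF gk(2)] by (simp add: increment_def)
    have "\<bar>integral {?g k..?g (Suc k)} (\<lambda>r. ?\<beta> r - ?\<beta> (?g k))\<bar> \<le> \<eta> * (?g (Suc k) - ?g k)"
    proof (rule integral_bound[where 'a = real, simplified real_norm_def])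
      show "continuous_on {?g k..?g (Suc k)} (\<lambda>r. ?\<beta> r - ?\<beta> (?g k))"
        using cont_k by (intro continuous_intros)
      show "\<bar>?\<beta> r - ?\<beta> (?g k)\<bar> \<le> \<eta>" if "r \<in> {?g k..?g (Suc k)}" for r
        using that gk gS by (intro osc) (auto simp: h_def)
    qed (use h gS in simp)
    moreover have "integral {?g k..?g (Suc k)} (\<lambda>r. ?\<beta> r - ?\<beta> (?g k))
        = integral {?g k..?g (Suc k)} ?\<beta> - h * ?\<beta> (?g k)"
      using h(1) by (subst Henstock_Kurzweil_Integration.integral_diff)
         (auto simp: gS intro!: integrable_continuous_real cont_k[unfolded gS])
    ultimately have local: "\<bar>integral {?g k..?g (Suc k)} ?\<beta> - h * ?\<beta> (?g k)\<bar> \<le> \<eta> * h"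
      using gS by simp
    have "\<bar>?\<beta> (?g k) - b (?E k) (?g k)\<bar> \<le> A * ?e" using gk by (intro lip) auto
    then have "\<bar>h * ?\<beta> (?g k) - h * b (?E k) (?g k)\<bar> \<le> h * (A * ?e)"
      using h(1) by (simp add: abs_mult flip: right_diff_distrib)
    moreover have "?E (Suc k) = ?E k + h * b (?E k) (?g k) + increment w t T n k"
      using gk by (simp add: euler_map_def h_def min.absorb2)
    ultimately have "\<bar>X (?g (Suc k)) - ?E (Suc k)\<bar> \<le> ?e + h * (A * ?e) + \<eta> * h"
      using XS local by linarith
    also have "\<dots> = (1 + h * A) * ?e + h * \<eta>" by (simp add: algebra_simps)
    also have "\<dots> \<le> (1 + h * A) * (k * h * \<eta> * (1 + h * A) ^ k) + h * \<eta> * (1 + h * A) ^ Suc k"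
    proof (rule add_mono)
      show "(1 + h * A) * ?e \<le> (1 + h * A) * (k * h * \<eta> * (1 + h * A) ^ k)"
        using Suc h(1) A by (intro mult_left_mono) auto
      have "1 \<le> (1 + h * A) ^ Suc k" using h(1) A by (intro one_le_power) auto
      then show "h * \<eta> \<le> h * \<eta> * (1 + h * A) ^ Suc k"
        using h(1) eta mult_left_mono[of 1 "(1 + h * A) ^ Suc k" "h * \<eta>"] by simp
    qed
    also have "\<dots> = Suc k * h * \<eta> * (1 + h * A) ^ Suc k" by (simp add: algebra_simps)
    finally show ?case .
  qed
  have "(1 + h * A) ^ n \<le> exp (h * A) ^ n"
    using h(1) A by (intro power_mono) auto
  also have "\<dots> = exp (A * (T - t))"
    by (simp flip: exp_of_nat_mult h(2) add: mult_ac)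
  finally have "n * h * \<eta> * (1 + h * A) ^ n \<le> n * h * \<eta> * exp (A * (T - t))"
    using h(1) eta by (intro mult_left_mono) auto
  with error[of n] show ?thesis by (simp add: grid_last[OF n] h(2))
qed

lemma euler_tendsto:
  fixes X w :: "real \<Rightarrow> real"
  assumes tT: "t < T" and A: "0 \<le> A"
    and lip: "\<And>y z s. s \<le> T \<Longrightarrow> \<bar>b y s - b z s\<bar> \<le> A * \<bar>y - z\<bar>"
    and cont: "continuous_on {t..T} (\<lambda>r. b (X r) r)"
    and X: "\<And>s. s \<in> {t..T} \<Longrightarrow> X s = y + integral {t..s} (\<lambda>r. b (X r) r) + (w s - w t)"
  shows "(\<lambda>n. chain (euler_map b t T n) (increment w t T n) y n) \<longlonglongrightarrow> X T"
proof (rule LIMSEQ_I)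
  fix e :: real
  assume e: "0 < e"
  define \<eta> where "\<eta> = e / (2 * (T - t) * exp (A * (T - t)))"
  have \<eta>: "0 < \<eta>" "(T - t) * \<eta> * exp (A * (T - t)) = e / 2" using e tT by (auto simp: \<eta>_def divide_simps)
  have "uniformly_continuous_on {t..T} (\<lambda>r. b (X r) r)"
    by (intro compact_uniformly_continuous cont) simp
  then obtain \<delta> where \<delta>: "0 < \<delta>"
    and osc: "\<And>r r'. r \<in> {t..T} \<Longrightarrow> r' \<in> {t..T} \<Longrightarrow> \<bar>r' - r\<bar> < \<delta> \<Longrightarrow> \<bar>b (X r') r' - b (X r) r\<bar> < \<eta>"
    using \<eta>(1) unfolding uniformly_continuous_on_def dist_real_def by metis
  obtain n0 :: nat where n0: "(T - t) / \<delta> < n0" using reals_Archimedean2 by blast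
  show "\<exists>n0. \<forall>n\<ge>n0. norm (chain (euler_map b t T n) (increment w t T n) y n - X T) < e"
  proof (intro exI allI impI)
    fix n
    assume "n0 \<le> n"
    then have n: "(T - t) / \<delta> < n" using n0 by linarith
    moreover have "0 < (T - t) / \<delta>" using tT \<delta> by simp
    ultimately have "0 < n" by (metis less_trans of_nat_0_less_iff)
    moreover have "(T - t) / n < \<delta>" using n \<delta> \<open>0 < n\<close> by (simp add: field_simps)
    ultimately have "\<bar>X T - chain (euler_map b t T n) (increment w t T n) y n\<bar>
        \<le> (T - t) * \<eta> * exp (A * (T - t))"
      by (intro euler_error[OF tT A _ lip cont X] less_imp_le[OF osc]) auto
    then show "norm (chain (euler_map b t T n) (increment w t T n) y n - X T) < e"
      using e \<eta>(2) by (simp add: abs_minus_commute)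
  qed
qed

section \<open>Passing to the limit in tail probabilities\<close>

lemma le_if_le_linear_error:
  fixes a b C :: real
  assumes "\<And>e. 0 < e \<Longrightarrow> e < 1 \<Longrightarrow> a \<le> b + C * e"
  shows "a \<le> b"
proof (rule tendsto_lowerbound)
  show "((\<lambda>e. b + C * e) \<longlongrightarrow> b) (at_right 0)" by (auto intro!: tendsto_eq_intros)
  show "\<forall>\<^sub>F e in at_right 0. a \<le> b + C * e"
    unfolding eventually_at_right_field using assms by (intro exI[of _ 1]) auto
qed simp

text \<open>The law of the limit might charge the level itself. Comparing two levels \<open>x < x'\<close> circumvents
  this: the events differ only where \<open>Zn n\<close> is at distance \<open>x' - x\<close> or more from \<open>Z\<close>.\<close>

lemma (in prob_space) eventually_prob_gt_close:
  fixes Z :: "'a \<Rightarrow> real"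
  assumes [measurable]: "random_variable borel Z" "\<And>n. random_variable borel (Zn n)"
    and lim: "AE \<omega> in M. (\<lambda>n. Zn n \<omega>) \<longlonglongrightarrow> Z \<omega>" and x: "x < x'" and e: "0 < e"
  shows "\<forall>\<^sub>F n in sequentially.
      prob {\<omega> \<in> space M. x' < Z \<omega>} \<le> prob {\<omega> \<in> space M. x < Zn n \<omega>} + e \<and>
      prob {\<omega> \<in> space M. x' < Zn n \<omega>} \<le> prob {\<omega> \<in> space M. x < Z \<omega>} + e"
proof -
  define D where "D n = {\<omega> \<in> space M. x' - x \<le> \<bar>Zn n \<omega> - Z \<omega>\<bar>}" for n
  have [measurable]: "D n \<in> events" for n unfolding D_def by measurable
  have "(\<lambda>n. expectation (indicator (D n) :: 'a \<Rightarrow> real)) \<longlonglongrightarrow> expectation (\<lambda>_. 0)"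
  proof (rule integral_dominated_convergence)
    show "AE \<omega> in M. (\<lambda>n. indicator (D n) \<omega> :: real) \<longlonglongrightarrow> 0"
      using lim
    proof eventually_elim
      case (elim \<omega>)
      have "\<forall>\<^sub>F n in sequentially. dist (Zn n \<omega>) (Z \<omega>) < x' - x"
        using elim x by (intro tendstoD) auto
      then have "\<forall>\<^sub>F n in sequentially. indicator (D n) \<omega> = (0 :: real)"
        by eventually_elim (auto simp: D_def dist_real_def indicator_def)
      then show ?case by (rule tendsto_eventually)
    qed
    show "integrable M (\<lambda>_. 1 :: real)" by simp
  qed (auto simp: indicator_def)
  then have "(\<lambda>n. prob (D n)) \<longlonglongrightarrow> 0" by simp
  then have "\<forall>\<^sub>F n in sequentially. prob (D n) < e" using e by (rule order_tendstoD)
  then show ?thesis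
  proof eventually_elim
    case (elim n)
    have "prob {\<omega> \<in> space M. x' < Z \<omega>} \<le> prob ({\<omega> \<in> space M. x < Zn n \<omega>} \<union> D n)"
      by (intro finite_measure_mono) (auto simp: D_def)
    also have "\<dots> \<le> prob {\<omega> \<in> space M. x < Zn n \<omega>} + prob (D n)"
      by (intro measure_Un_le) auto
    finally have 1: "prob {\<omega> \<in> space M. x' < Z \<omega>} \<le> prob {\<omega> \<in> space M. x < Zn n \<omega>} + prob (D n)" .
    have "prob {\<omega> \<in> space M. x' < Zn n \<omega>} \<le> prob ({\<omega> \<in> space M. x < Z \<omega>} \<union> D n)"
      by (intro finite_measure_mono) (auto simp: D_def)
    also have "\<dots> \<le> prob {\<omega> \<in> space M. x < Z \<omega>} + prob (D n)"
      by (intro measure_Un_le) auto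
    finally show ?case using 1 elim by linarith
  qed
qed

lemma (in prob_space) prob_gt_right_continuous:
  assumes [measurable]: "random_variable borel Z"
  shows "(\<lambda>i. prob {\<omega> \<in> space M. x + 1 / real (Suc i) < Z \<omega>}) \<longlonglongrightarrow> prob {\<omega> \<in> space M. x < Z \<omega>}"
proof -
  let ?A = "\<lambda>i. {\<omega> \<in> space M. x + 1 / real (Suc i) < Z \<omega>}"
  have "incseq ?A"
  proof (rule incseq_SucI)
    show "?A i \<subseteq> ?A (Suc i)" for i
      using inverse_of_nat_le[of "Suc i" "Suc (Suc i)", where 'a = real] by auto
  qed
  moreover have "(\<Union>i. ?A i) = {\<omega> \<in> space M. x < Z \<omega>}"
  proof (intro set_eqI iffI)
    fix \<omega>
    assume "\<omega> \<in> (\<Union>i. ?A i)"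
    then obtain i where "\<omega> \<in> space M" "x + 1 / real (Suc i) < Z \<omega>" by auto
    moreover have "0 < 1 / real (Suc i)" by simp
    ultimately have "x < Z \<omega>" by linarith
    with \<open>\<omega> \<in> space M\<close> show "\<omega> \<in> {\<omega> \<in> space M. x < Z \<omega>}" by simp
  next
    fix \<omega>
    assume "\<omega> \<in> {\<omega> \<in> space M. x < Z \<omega>}"
    moreover from this obtain i where "inverse (real (Suc i)) < Z \<omega> - x"
      using reals_Archimedean[of "Z \<omega> - x"] by auto
    ultimately show "\<omega> \<in> (\<Union>i. ?A i)" by (auto simp: inverse_eq_divide algebra_simps intro!: exI[of _ i])
  qed
  moreover have "range ?A \<subseteq> events" by auto
  ultimately show ?thesis
    using finite_Lim_measure_incseq[of ?A] by simp
qed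

lemma (in brownian_motion) scaled_increments:
  assumes t: "0 \<le> t" "t < T" and n: "0 < n" and c: "0 < c"
  shows "indep_vars (\<lambda>_. borel) (\<lambda>k \<omega>. increment (\<lambda>s. c * W s \<omega>) t T n k) {..<n}"
    and "distributed M lborel (\<lambda>\<omega>. increment (\<lambda>s. c * W s \<omega>) t T n k)
           (normal_density 0 (c * sqrt ((T - t) / n)))"
proof -
  have h: "0 < (T - t) / n" using t n by simp
  have nonneg: "0 \<le> grid t T n k" for k using t h by (simp add: grid_def)
  have eq: "increment (\<lambda>s. c * W s \<omega>) t T n k = c * (W (grid t T n (Suc k)) \<omega> - W (grid t T n k) \<omega>)" for k \<omega>
    by (simp add: increment_def right_diff_distrib)
  have "indep_vars (\<lambda>_. borel) (\<lambda>k \<omega>. W (grid t T n (Suc k)) \<omega> - W (grid t T n k) \<omega>) {..<n}"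
    using h by (intro indep_increments nonneg) (simp add: grid_Suc)
  from indep_vars_compose2[OF this, of "\<lambda>_ z. c * z" "\<lambda>_. borel"]
  show "indep_vars (\<lambda>_. borel) (\<lambda>k \<omega>. increment (\<lambda>s. c * W s \<omega>) t T n k) {..<n}"
    unfolding eq by simp
  have "distributed M lborel (\<lambda>\<omega>. W (grid t T n (Suc k)) \<omega> - W (grid t T n k) \<omega>)
      (normal_density 0 (sqrt (grid t T n (Suc k) - grid t T n k)))"
    using h by (intro normal_increments nonneg) (simp add: grid_Suc)
  from normal_density_affine[OF this, of c 0]
  show "distributed M lborel (\<lambda>\<omega>. increment (\<lambda>s. c * W s \<omega>) t T n k)
      (normal_density 0 (c * sqrt ((T - t) / n)))"
    using h c unfolding eq by (simp add: grid_Suc)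
qed

section \<open>Equations with concave drift\<close>

locale concave_drift_sde = brownian_motion M W
  for M :: "'a measure" and W :: "real \<Rightarrow> 'a \<Rightarrow> real" +
  fixes b :: "real \<Rightarrow> real \<Rightarrow> real" and A t T \<epsilon> :: real and Y :: "real \<Rightarrow> real \<Rightarrow> 'a \<Rightarrow> real"
  assumes t: "0 \<le> t" and tT: "t < T" and A: "0 \<le> A" and eps: "0 < \<epsilon>"
    and lip: "\<And>y z s. s \<le> T \<Longrightarrow> \<bar>b y s - b z s\<bar> \<le> A * \<bar>y - z\<bar>"
    and cont: "continuous_on (UNIV \<times> {..T}) (\<lambda>(y, s). b y s)"
    and conc: "\<And>s. s \<le> T \<Longrightarrow> concave_on UNIV (\<lambda>y. b y s)"
    and sol: "\<And>y. sde_solution M W b \<epsilon> t T y (Y y)"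
begin

abbreviation \<phi> :: "nat \<Rightarrow> nat \<Rightarrow> real \<Rightarrow> real" where "\<phi> \<equiv> euler_map b t T"

definition euler :: "nat \<Rightarrow> real \<Rightarrow> 'a \<Rightarrow> real" where
  "euler n y \<omega> = chain (\<phi> n) (\<lambda>k. increment (\<lambda>s. sqrt \<epsilon> * W s \<omega>) t T n k) y n"

definition euler_tail :: "nat \<Rightarrow> real \<Rightarrow> real \<Rightarrow> real" where
  "euler_tail n x y = prob {\<omega> \<in> space M. x < euler n y \<omega>}"

text \<open>Steps this small make the Euler maps increasing.\<close>

definition small_step :: "nat \<Rightarrow> bool" where
  "small_step n \<longleftrightarrow> 0 < n \<and> (T - t) / n * A \<le> 1"

abbreviation "u \<equiv> u_eps M Y T"

lemma eventually_small_step: "\<forall>\<^sub>F n in sequentially. small_step n"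
proof -
  have "(\<lambda>n. (T - t) * A / real n) \<longlonglongrightarrow> 0" by (rule lim_const_over_n)
  then have "\<forall>\<^sub>F n in sequentially. (T - t) * A / real n < 1" by (rule order_tendstoD) simp
  with eventually_gt_at_top[of "0 :: nat"] show ?thesis
    by eventually_elim (simp add: small_step_def)
qed

text \<open>Both bounds come from the Lipschitz drift. The lower one separates solutions, the upper one
  controls the Harnack constant.\<close>

lemma euler_map_increment:
  assumes "0 \<le> d"
  shows "\<phi> n k y + (1 - (T - t) / n * A) * d \<le> \<phi> n k (y + d)"
    and "\<phi> n k (y + d) \<le> \<phi> n k y + (1 + (T - t) / n * A) * d"
proof -
  let ?s = "min T (grid t T n k)"
  have "\<bar>b (y + d) ?s - b y ?s\<bar> \<le> A * d" using lip[of ?s "y + d" y] assms by simp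
  then have "\<bar>(T - t) / n * (b (y + d) ?s - b y ?s)\<bar> \<le> (T - t) / n * (A * d)"
    using tT by (simp add: abs_mult divide_right_mono mult_left_mono)
  then show "\<phi> n k y + (1 - (T - t) / n * A) * d \<le> \<phi> n k (y + d)"
    and "\<phi> n k (y + d) \<le> \<phi> n k y + (1 + (T - t) / n * A) * d"
    unfolding euler_map_def by (simp_all add: abs_le_iff algebra_simps)
qed

lemma mono_euler_map: "small_step n \<Longrightarrow> mono (\<phi> n k)"
proof (rule monoI)
  fix y z :: real
  assume n: "small_step n" and yz: "y \<le> z"
  have "0 \<le> (1 - (T - t) / n * A) * (z - y)" using n yz by (simp add: small_step_def)
  then show "\<phi> n k y \<le> \<phi> n k z"
    using euler_map_increment(1)[of "z - y" n k y] yz by simp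
qed

lemma concave_euler_map: "concave_on UNIV (\<phi> n k)"
proof -
  have "concave_on UNIV (\<lambda>y. (T - t) / real n * b y (min T (grid t T n k)))"
    using conc[of "min T (grid t T n k)"] tT unfolding concave_on_def
    by (subst minus_mult_right) (intro convex_on_cmul, auto)
  then show ?thesis
    unfolding euler_map_def by (intro concave_on_add) (auto simp: concave_on_def convex_on_def algebra_simps)
qed

lemma measurable_euler_map [measurable]: "\<phi> n k \<in> borel_measurable borel"
proof -
  have "continuous_on UNIV (\<lambda>y. b y (min T (grid t T n k)))"
    by (rule continuous_on_compose2[OF cont, where f = "\<lambda>y. (y, min T (grid t T n k))", simplified])
       (auto intro!: continuous_intros)
  then show ?thesis
    unfolding euler_map_def by (intro borel_measurable_continuous_onI continuous_intros)
qed

lemma measurable_euler [measurable]: "euler n y \<in> borel_measurable M"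
  unfolding euler_def
proof (intro measurable_chain measurable_euler_map)
  fix k
  assume "k < n"
  then have "grid t T n k \<in> {t..T}" "grid t T n (Suc k) \<in> {t..T}"
    by (auto intro!: grid_mem[OF tT] simp del: atLeastAtMost_iff)
  then have [measurable]: "W (grid t T n k) \<in> borel_measurable M" "W (grid t T n (Suc k)) \<in> borel_measurable M"
    using t by (auto intro!: random_variable_W)
  show "(\<lambda>\<omega>. increment (\<lambda>s. sqrt \<epsilon> * W s \<omega>) t T n k) \<in> borel_measurable M"
    unfolding increment_def by measurable
qed

lemma measurable_Y [measurable]: "Y y T \<in> borel_measurable M"
  using sol[of y] tT by (auto simp: sde_solution_def)

lemma euler_converges: "AE \<omega> in M. (\<lambda>n. euler n y \<omega>) \<longlonglongrightarrow> Y y T \<omega>"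
proof -
  have "AE \<omega> in M. continuous_on {t..T} (\<lambda>s. Y y s \<omega>) \<and>
        (\<forall>s\<in>{t..T}. Y y s \<omega> = y + integral {t..s} (\<lambda>r. b (Y y r \<omega>) r) + sqrt \<epsilon> * (W s \<omega> - W t \<omega>))"
    using sol[of y] by (simp add: sde_solution_def)
  then show ?thesis
  proof eventually_elim
    case (elim \<omega>)
    have drift: "continuous_on {t..T} (\<lambda>r. b (Y y r \<omega>) r)"
      by (rule continuous_on_compose2[OF cont, where f = "\<lambda>r. (Y y r \<omega>, r)", simplified])
         (use elim in \<open>auto intro!: continuous_intros\<close>)
    show ?case
      unfolding euler_def
      by (rule euler_tendsto[OF tT A lip drift]) (use elim in \<open>auto simp: right_diff_distrib\<close>)
  qed
qed

lemma euler_tail_eq: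
  assumes "small_step n"
  shows "euler_tail n x y = tail_prob (\<phi> n) (sqrt \<epsilon> * sqrt ((T - t) / n)) x n 0 y"
  unfolding euler_tail_def euler_def using assms eps tT
  by (intro tail_prob_chain scaled_increments t mono_euler_map) (auto simp: small_step_def)

lemma euler_tail_bounds: "0 \<le> euler_tail n x y" "euler_tail n x y \<le> 1"
  by (simp_all add: euler_tail_def)

text \<open>In the last part the distance \<open>D\<close> is split evenly over the \<open>n\<close> steps, and the dependence on
  \<open>n\<close> cancels.\<close>

lemma euler_tail_properties:
  assumes n: "small_step n"
  shows "mono (euler_tail n x)" and "log_concave (euler_tail n x)"
    and "0 \<le> D \<Longrightarrow> (euler_tail n x (y + D))\<^sup>2
           \<le> exp (D\<^sup>2 * (1 + A * (T - t))\<^sup>2 / (\<epsilon> * (T - t))) * euler_tail n x y"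
proof -
  define s where "s = sqrt \<epsilon> * sqrt ((T - t) / n)"
  have s: "0 < s" "s\<^sup>2 = \<epsilon> * (T - t) / n"
    using eps tT n by (auto simp: s_def small_step_def power_mult_distrib)
  have eq: "euler_tail n x = tail_prob (\<phi> n) s x n 0"
    using euler_tail_eq[OF n] by (auto simp: s_def)
  show "mono (euler_tail n x)"
    using mono_unit_tail_prob[OF mono_euler_map[OF n] s(1)] by (simp add: eq mono_unit_def)
  show "log_concave (euler_tail n x)"
    unfolding eq by (rule log_concave_tail_prob[OF mono_euler_map[OF n] concave_euler_map s(1)])
  assume D: "0 \<le> D"
  have n0: "0 < n" using n by (simp add: small_step_def)
  have "(euler_tail n x (y + n * (D / n)))\<^sup>2
      \<le> exp (n * ((D / n * (1 + (T - t) / n * A * n))\<^sup>2 / s\<^sup>2)) * euler_tail n x y"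
    unfolding eq using D A tT
    by (intro tail_prob_harnack mono_euler_map n s euler_map_increment) auto
  moreover have "n * ((D / n * (1 + (T - t) / n * A * n))\<^sup>2 / s\<^sup>2)
      = D\<^sup>2 * (1 + A * (T - t))\<^sup>2 / (\<epsilon> * (T - t))"
    using n0 by (simp add: s(2) power_mult_distrib power_divide mult.commute)
       (simp add: power2_eq_square)
  ultimately show "(euler_tail n x (y + D))\<^sup>2
      \<le> exp (D\<^sup>2 * (1 + A * (T - t))\<^sup>2 / (\<epsilon> * (T - t))) * euler_tail n x y"
    using n0 by simp
qed

lemma eventually_euler_tail_close:
  assumes "x < x'" "0 < e"
  shows "\<forall>\<^sub>F n in sequentially. u x' y \<le> euler_tail n x y + e \<and> euler_tail n x' y \<le> u x y + e"
  unfolding euler_tail_def u_eps_def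
  by (rule eventually_prob_gt_close[OF _ _ euler_converges assms]) auto

lemma u_bounds: "0 \<le> u x y" "u x y \<le> 1"
  by (simp_all add: u_eps_def)

lemma u_right_continuous: "(\<lambda>i. u (x + 1 / real (Suc i)) y) \<longlonglongrightarrow> u x y"
  unfolding u_eps_def by (rule prob_gt_right_continuous) simp

lemma obtain_close_euler_tail:
  assumes x: "x < x'" and e: "0 < e"
  obtains n z where "small_step n" "\<And>y. y \<in> {y1, y2, y3} \<Longrightarrow> u x' y \<le> euler_tail n z y + e"
    "\<And>y. y \<in> {y1, y2, y3} \<Longrightarrow> euler_tail n z y \<le> u x y + e"
proof -
  define z where "z = (x + x') / 2"
  have z: "x < z" "z < x'" using x by (auto simp: z_def)
  have "\<forall>\<^sub>F n in sequentially. small_step n \<and>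
      (\<forall>y\<in>{y1, y2, y3}. u x' y \<le> euler_tail n z y + e \<and> euler_tail n z y \<le> u x y + e)"
    using eventually_small_step eventually_euler_tail_close[OF z(1) e] eventually_euler_tail_close[OF z(2) e]
    by (auto simp: eventually_conj_iff)
  then obtain n where "small_step n \<and>
      (\<forall>y\<in>{y1, y2, y3}. u x' y \<le> euler_tail n z y + e \<and> euler_tail n z y \<le> u x y + e)"
    using eventually_happens'[OF sequentially_bot] by blast
  then show ?thesis using that by blast
qed

lemma mono_u: "mono (u x)"
proof (rule monoI)
  fix y1 y2 :: real
  assume y: "y1 \<le> y2"
  have shifted: "u x' y1 \<le> u x y2" if x: "x < x'" for x'
  proof (rule le_if_le_linear_error[where C = 2])
    fix e :: real
    assume "0 < e"
    from obtain_close_euler_tail[OF x this, of y1 y2 y2]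
    obtain n z where "small_step n" "u x' y1 \<le> euler_tail n z y1 + e" "euler_tail n z y2 \<le> u x y2 + e"
      by (metis insertI1 insertI2)
    then show "u x' y1 \<le> u x y2 + 2 * e"
      using monoD[OF euler_tail_properties(1)[of n z] y] by linarith
  qed
  show "u x y1 \<le> u x y2"
    by (rule LIMSEQ_le_const2[OF u_right_continuous]) (auto intro!: shifted)
qed

text \<open>The limit of the four-point inequality with \<open>d = e\<close>, first with the level on the left raised to
  \<open>x'\<close>, then with \<open>x'\<close> decreasing to \<open>x\<close>.\<close>

lemma u_midpoint: "u x y1 * u x y2 \<le> (u x ((y1 + y2) / 2))\<^sup>2"
proof (induction y1 y2 rule: linorder_wlog)
  case (le y1 y2)
  define m where "m = (y1 + y2) / 2"
  have shifted: "u x' y1 * u x' y2 \<le> (u x m)\<^sup>2" if x: "x < x'" for x'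
  proof (rule le_if_le_linear_error[where C = 6])
    fix e :: real
    assume e: "0 < e" "e < 1"
    from obtain_close_euler_tail[OF x e(1), of y1 y2 m]
    obtain n z where n: "small_step n" and close: "u x' y1 \<le> euler_tail n z y1 + e"
        "u x' y2 \<le> euler_tail n z y2 + e" "euler_tail n z m \<le> u x m + e"
      by (metis insertI1 insertI2)
    note b = euler_tail_bounds[of n z y1] euler_tail_bounds[of n z y2] euler_tail_bounds[of n z m]
      u_bounds[of x m]
    have ee: "e * e \<le> e" using e by simp
    have "u x' y1 * u x' y2 \<le> (euler_tail n z y1 + e) * (euler_tail n z y2 + e)"
      using close u_bounds e b by (intro mult_mono) auto
    also have "\<dots> = euler_tail n z y1 * euler_tail n z y2 + e * euler_tail n z y1 + e * euler_tail n z y2 + e * e"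
      by (simp add: algebra_simps)
    also have "\<dots> \<le> euler_tail n z y1 * euler_tail n z y2 + 3 * e"
      using mult_left_le[OF b(2), of e] mult_left_le[OF b(4), of e] e ee by linarith
    also have "euler_tail n z y1 * euler_tail n z y2 \<le> (euler_tail n z m)\<^sup>2"
      using euler_tail_properties(2)[OF n, of z, unfolded log_concave_def, rule_format, of "m - y1" "m - y1" y1] le
      by (simp add: m_def power2_eq_square field_simps)
    also have "(euler_tail n z m)\<^sup>2 \<le> (u x m + e)\<^sup>2"
      using close b by (intro power_mono) auto
    also have "\<dots> = (u x m)\<^sup>2 + 2 * (e * u x m) + e * e" by (simp add: power2_eq_square algebra_simps)
    also have "\<dots> \<le> (u x m)\<^sup>2 + 3 * e"
      using mult_left_le[OF b(8), of e] e ee by linarith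
    finally show "u x' y1 * u x' y2 \<le> (u x m)\<^sup>2 + 6 * e" by simp
  qed
  have "u x y1 * u x y2 \<le> (u x m)\<^sup>2"
    by (rule LIMSEQ_le_const2[OF tendsto_mult[OF u_right_continuous u_right_continuous]])
       (auto intro!: shifted)
  then show ?case by (simp add: m_def)
next
  case (sym y1 y2)
  then show ?case by (simp add: mult.commute add.commute)
qed

text \<open>The constant of the Harnack inequality for the Euler scheme does not depend on the number of
  steps, so the inequality survives in the limit, between two levels. It carries positivity of
  a tail probability from a distant start, where it is evident, to every start.\<close>

lemma u_harnack:
  assumes x: "x < x'" and D: "0 \<le> D"
  shows "(u x' (y + D))\<^sup>2 \<le> exp (D\<^sup>2 * (1 + A * (T - t))\<^sup>2 / (\<epsilon> * (T - t))) * u x y"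
proof -
  define K where "K = exp (D\<^sup>2 * (1 + A * (T - t))\<^sup>2 / (\<epsilon> * (T - t)))"
  have "(u x' (y + D))\<^sup>2 \<le> K * u x y"
  proof (rule le_if_le_linear_error[where C = "K + 3"])
    fix e :: real
    assume e: "0 < e" "e < 1"
    from obtain_close_euler_tail[OF x e(1), of y "y + D" y]
    obtain n z where n: "small_step n" and close: "u x' (y + D) \<le> euler_tail n z (y + D) + e"
        "euler_tail n z y \<le> u x y + e"
      by (metis insertI1 insertI2)
    have "(u x' (y + D))\<^sup>2 \<le> (euler_tail n z (y + D) + e)\<^sup>2"
      using close u_bounds by (intro power_mono) auto
    also have "\<dots> = (euler_tail n z (y + D))\<^sup>2 + 2 * (e * euler_tail n z (y + D)) + e * e"
      by (simp add: power2_eq_square algebra_simps)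
    also have "\<dots> \<le> (euler_tail n z (y + D))\<^sup>2 + 3 * e"
    proof -
      have "e * e \<le> e" using e by simp
      then show ?thesis using mult_left_le[OF euler_tail_bounds(2), of e n z "y + D"] e by linarith
    qed
    also have "(euler_tail n z (y + D))\<^sup>2 \<le> K * euler_tail n z y"
      unfolding K_def by (rule euler_tail_properties(3)[OF n D])
    also have "\<dots> \<le> K * (u x y + e)" using close by (intro mult_left_mono) (auto simp: K_def)
    finally show "(u x' (y + D))\<^sup>2 \<le> K * u x y + (K + 3) * e" by (simp add: algebra_simps)
  qed
  then show ?thesis by (simp add: K_def)
qed

text \<open>Two solutions approach each other at most at the exponential rate \<open>A\<close>, because one Euler step
  multiplies distances by at least \<open>1 - A * (T - t) / n\<close>.\<close>

lemma solution_gap: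
  assumes d: "0 \<le> d"
  shows "AE \<omega> in M. Y y T \<omega> + exp (- A * (T - t)) * d \<le> Y (y + d) T \<omega>"
  using euler_converges[of y] euler_converges[of "y + d"]
proof eventually_elim
  case (elim \<omega>)
  have "(\<lambda>n. (1 + (- A * (T - t)) / real n) ^ n) \<longlonglongrightarrow> exp (- A * (T - t))"
    by (rule tendsto_exp_limit_sequentially)
  then have "(\<lambda>n. euler n y \<omega> + (1 + (- A * (T - t)) / real n) ^ n * d)
      \<longlonglongrightarrow> Y y T \<omega> + exp (- A * (T - t)) * d"
    by (intro tendsto_intros elim)
  then show ?case
  proof (rule tendsto_le[OF sequentially_bot elim(2)])
    show "\<forall>\<^sub>F n in sequentially. euler n y \<omega> + (1 + (- A * (T - t)) / real n) ^ n * d \<le> euler n (y + d) \<omega>"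
      using eventually_small_step
    proof eventually_elim
      case (elim n)
      have eq: "1 + (- A * (T - t)) / real n = 1 - (T - t) / n * A" by (simp add: mult.commute)
      show ?case
        unfolding euler_def eq
        by (rule chain_gap[OF euler_map_increment(1) _ d]) (use elim in \<open>auto simp: small_step_def\<close>)
    qed
  qed
qed

text \<open>By the preceding bound, solutions with sufficiently large initial value exceed any level with
  positive probability; the Harnack inequality transfers this to the initial value \<open>y\<close>.\<close>

lemma u_pos: "0 < u x y"
proof -
  have "\<exists>m :: nat. u (x + 1) (y + real m) \<noteq> 0"
  proof (rule ccontr)
    assume "\<not> ?thesis"
    then have "AE \<omega> in M. \<forall>m :: nat. \<not> x + 1 < Y (y + real m) T \<omega>"
      unfolding AE_all_countable u_eps_def by (simp add: prob_Collect_eq_0)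
    moreover have "AE \<omega> in M. \<forall>m :: nat. Y y T \<omega> + exp (- A * (T - t)) * real m \<le> Y (y + real m) T \<omega>"
      unfolding AE_all_countable by (intro allI solution_gap) simp
    ultimately have "AE \<omega> in M. False"
    proof eventually_elim
      case (elim \<omega>)
      obtain m :: nat where "(x + 1 - Y y T \<omega>) / exp (- A * (T - t)) < m"
        using reals_Archimedean2 by blast
      then have "x + 1 < Y y T \<omega> + exp (- A * (T - t)) * m"
        by (simp add: field_simps)
      with elim show ?case by (metis less_le_trans)
    qed
    then show False by simp
  qed
  then obtain m :: nat where m: "u (x + 1) (y + real m) \<noteq> 0" ..
  have "0 < (u (x + 1) (y + real m))\<^sup>2" using m by simp
  also have "\<dots> \<le> exp ((real m)\<^sup>2 * (1 + A * (T - t))\<^sup>2 / (\<epsilon> * (T - t))) * u x y"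
    by (rule u_harnack) auto
  finally show ?thesis by (simp add: zero_less_mult_iff)
qed

lemma convex_q: "convex_on UNIV (q_eps \<epsilon> M Y T x)"
proof (rule convex_on_midpoint_antimono)
  show "antimono (q_eps \<epsilon> M Y T x)"
    using monoD[OF mono_u] u_pos eps by (intro antimonoI) (auto simp: q_eps_def)
  show "q_eps \<epsilon> M Y T x ((y1 + y2) / 2) \<le> (q_eps \<epsilon> M Y T x y1 + q_eps \<epsilon> M Y T x y2) / 2" for y1 y2
  proof -
    have "ln (u x y1 * u x y2) \<le> ln ((u x ((y1 + y2) / 2))\<^sup>2)"
      using u_pos u_midpoint by (intro ln_mono) auto
    then have "ln (u x y1) + ln (u x y2) \<le> 2 * ln (u x ((y1 + y2) / 2))"
      using u_pos[of x y1] u_pos[of x y2] u_pos[of x "(y1 + y2) / 2"] by (simp add: ln_mult ln_realpow)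
    from mult_left_mono[OF this, of \<epsilon>] eps show ?thesis
      by (simp add: q_eps_def algebra_simps)
  qed
qed

end

section \<open>Convexity of the logarithmic transform\<close>

theorem theoremA1:
  fixes M :: "'a measure" and W :: "real \<Rightarrow> 'a \<Rightarrow> real"
    and Y :: "real \<Rightarrow> real \<Rightarrow> 'a \<Rightarrow> real"
    and b :: "real \<Rightarrow> real \<Rightarrow> real"
    and T A \<epsilon> t x :: real
  assumes "T > 0" and "A \<ge> 0"
    and "continuous_on (UNIV \<times> {..T}) (\<lambda>(y, s). b y s)"
    and "\<And>y s. s \<le> T \<Longrightarrow> (\<lambda>z. b z s) field_differentiable (at y)"
    and "continuous_on (UNIV \<times> {..T}) (\<lambda>(y, s). deriv (\<lambda>z. b z s) y)"
    and "\<And>y s. s \<le> T \<Longrightarrow> \<bar>deriv (\<lambda>z. b z s) y\<bar> \<le> A"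
    and "\<And>s. s \<le> T \<Longrightarrow> concave_on UNIV (\<lambda>y. b y s)"
    and "\<epsilon> > 0"
    and "0 \<le> t" and "t < T"
    and "brownian_motion M W"
    and "\<And>y. sde_solution M W b \<epsilon> t T y (Y y)"
  shows "convex_on UNIV (\<lambda>y. q_eps \<epsilon> M Y T x y)"
proof -
  have lip: "\<bar>b y s - b z s\<bar> \<le> A * \<bar>y - z\<bar>" if "s \<le> T" for y z s
    using field_differentiable_bound[of UNIV "\<lambda>z. b z s" "deriv (\<lambda>z. b z s)" A y z]
      field_differentiable_derivI[OF assms(4)[OF that]] assms(6)[OF that]
    by simp
  interpret brownian_motion M W by (rule assms)
  interpret concave_drift_sde M W b A t T \<epsilon> Y
    by unfold_locales (use assms lip in auto)
  show ?thesis using convex_q .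
qed

end
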